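(* Let $A\in\mathcal{M}_n$ be accretive-dissipative, and let $0<t<1$. Then $A^t$ is accretive-dissipative.
   Context: $\mathcal{M}_n$ is the algebra of $n\times n$ complex matrices. The numerical range is $W(A)=\{\langle Ax,x\rangle : x\in\mathbb{C}^n,\ \|x\|=1\}$. A matrix is positive definite, written $A>O$, if $W(A)\subset(0,\infty)$. Write $\Re(A)=\frac{A+A^*}{2}$ and $\Im(A)=\frac{A-A^*}{2i}$. $A$ is accretive-dissipative if both $\Re(A)>O$ and $\Im(A)>O$. For $A$ with $W(A)\cap(-\infty,0]=\varnothing$ and $t\in(0,1)$, $A^t$ is the principal fractional power \[ A^t=\frac{1}{2\pi i}\int_{\Omega_A} z^t(zI-A)^{-1}\,dz, \] where $z^t$ is the principal power and $\Omega_A$ is a contour in the resolvent set of $A$ that winds once about each eigenvalue of $A$ and avoids $(-\infty,0]$. Equivalently, $A^t=\frac{\sin(t\pi)}{\pi}\int_0^\infty s^{t-1}A(sI+A)^{-1}\,ds$. *)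

theory Defs
  imports "HOL-Complex_Analysis.Complex_Analysis"
begin

definition herm_inner :: "complex ^ 'n \<Rightarrow> complex ^ 'n \<Rightarrow> complex" where
  "herm_inner x y = (\<Sum>i\<in>UNIV. x $ i * cnj (y $ i))"

definition conj_transpose :: "complex ^ 'n ^ 'n \<Rightarrow> complex ^ 'n ^ 'n" where
  "conj_transpose A = (\<chi> i j. cnj (A $ j $ i))"

definition matrix_Re :: "complex ^ 'n ^ 'n \<Rightarrow> complex ^ 'n ^ 'n" where
  "matrix_Re A = (\<chi> i j. (A + conj_transpose A) $ i $ j / 2)"

definition matrix_Im :: "complex ^ 'n ^ 'n \<Rightarrow> complex ^ 'n ^ 'n" where
  "matrix_Im A = (\<chi> i j. (A - conj_transpose A) $ i $ j / (2 * \<i>))"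

definition numerical_range :: "complex ^ 'n ^ 'n \<Rightarrow> complex set" where
  "numerical_range A = {herm_inner (A *v x) x | x. norm x = 1}"

definition pos_definite :: "complex ^ 'n ^ 'n \<Rightarrow> bool" where
  "pos_definite A \<longleftrightarrow> numerical_range A \<subseteq> complex_of_real ` {0<..}"

definition accretive_dissipative :: "complex ^ 'n ^ 'n \<Rightarrow> bool" where
  "accretive_dissipative A \<longleftrightarrow> pos_definite (matrix_Re A) \<and> pos_definite (matrix_Im A)"

definition matrix_eigenvalues :: "complex ^ 'n ^ 'n \<Rightarrow> complex set" where
  "matrix_eigenvalues A = {z. \<exists>x. x \<noteq> 0 \<and> A *v x = z *s x}"

definition resolvent_set :: "complex ^ 'n ^ 'n \<Rightarrow> complex set" where
  "resolvent_set A = {z. invertible (mat z - A)}"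

definition power_contour :: "complex ^ 'n ^ 'n \<Rightarrow> (real \<Rightarrow> complex) \<Rightarrow> bool" where
  "power_contour A \<gamma> \<longleftrightarrow>
     valid_path \<gamma> \<and> pathfinish \<gamma> = pathstart \<gamma> \<and>
     path_image \<gamma> \<subseteq> resolvent_set A - \<real>\<^sub>\<le>\<^sub>0 \<and>
     (\<forall>z \<in> matrix_eigenvalues A. winding_number \<gamma> z = 1)"

(* The matrix-valued contour integral is taken entrywise; z powr of_real t = exp (t * Ln z) is the
   principal power. By Cauchy's theorem the value does not depend on the admissible contour: as
   such a contour avoids the half-line, it has winding number 0 about each of its points.
   The definition is meaningful when the numerical range of A does not meet the closed negative
   half-line; an admissible contour then exists. *)
definition frac_power :: "complex ^ 'n ^ 'n \<Rightarrow> real \<Rightarrow> complex ^ 'n ^ 'n" where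
  "frac_power A t =
     (let \<gamma> = (SOME \<gamma>. power_contour A \<gamma>)
      in \<chi> i j. 1 / (2 * of_real pi * \<i>) *
           contour_integral \<gamma> (\<lambda>z. z powr of_real t * matrix_inv (mat z - A) $ i $ j))"

end

theory Submission
  imports Defs
begin

text \<open>
  Write \<open>g(z) = \<langle>(zI - A)\<^sup>-\<^sup>1x, x\<rangle>\<close>. For accretive \<open>A\<close> and large real \<open>c\<close> the operator norm of \<open>A - cI\<close>
  is some \<open>\<rho> < c\<close>, so a circle around \<open>c\<close> of radius \<open>r\<close> with \<open>\<rho> < r < c\<close> is an admissible contour lying in
  the right half-plane, and by the residue theorem \<open>\<langle>A\<^sup>tx, x\<rangle>\<close> is the integral of \<open>z\<^sup>t g(z) / 2\<pi>i\<close> over this circle.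

  Instead of deforming the circle to a keyhole around the cut, one approximates \<open>z\<^sup>t\<close> uniformly on the disc,
  up to a nonnegative factor, by \<open>f(z) = \<integral>\<^sub>a\<^sup>b s\<^sup>t\<^sup>-\<^sup>1 z / (s + z) ds\<close>: integration by parts gives
  \<open>t f(z) - z f'(z) = [s\<^sup>t z / (s + z)]\<^sub>a\<^sup>b\<close>, which tends to 0 as \<open>a \<rightarrow> 0\<close> and \<open>b \<rightarrow> \<infinity>\<close>, so \<open>f\<close> nearly solves
  the differential equation of \<open>z\<^sup>t\<close>. Exchanging the two integrals, the integral of \<open>f(z) g(z) / 2\<pi>i\<close> equals
  \<open>\<integral>\<^sub>a\<^sup>b s\<^sup>t\<^sup>-\<^sup>1 \<langle>A(sI + A)\<^sup>-\<^sup>1x, x\<rangle> ds\<close>, where with \<open>y = (sI + A)\<^sup>-\<^sup>1x\<close> the inner product is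
  \<open>s\<langle>Ay, y\<rangle> + \<parallel>Ay\<parallel>\<^sup>2\<close> and lies in the open first quadrant. The part over \<open>[1, 2]\<close> keeps its real and imaginary
  parts away from 0 in the limit.
\<close>

subsection \<open>Quadratic forms\<close>

lemma herm_inner_add_left: "herm_inner (u + v) x = herm_inner u x + herm_inner v x"
  by (simp add: herm_inner_def sum.distrib distrib_right)

lemma herm_inner_diff_left: "herm_inner (u - v) x = herm_inner u x - herm_inner v x"
  by (simp add: herm_inner_def sum_subtractf left_diff_distrib)

lemma herm_inner_scale_left: "herm_inner (a *s u) x = a * herm_inner u x"
  by (simp add: herm_inner_def sum_distrib_left mult.assoc)

lemma herm_inner_commute: "herm_inner y x = cnj (herm_inner x y)"
  by (simp add: herm_inner_def cnj_sum mult.commute)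

lemma herm_inner_add_right: "herm_inner x (u + v) = herm_inner x u + herm_inner x v"
  by (simp add: herm_inner_def sum.distrib distrib_left)

lemma herm_inner_diff_right: "herm_inner x (u - v) = herm_inner x u - herm_inner x v"
  by (simp add: herm_inner_def sum_subtractf right_diff_distrib)

lemma herm_inner_scale_right: "herm_inner x (a *s u) = cnj a * herm_inner x u"
  by (simp add: herm_inner_def sum_distrib_left mult_ac)

lemma herm_inner_self: "herm_inner x x = of_real ((norm x)\<^sup>2)"
proof -
  have "(norm x)\<^sup>2 = (\<Sum>i\<in>UNIV. (norm (x $ i))\<^sup>2)"
    by (simp add: norm_vec_def L2_set_def sum_nonneg)
  then show ?thesis
    by (simp only: herm_inner_def of_real_sum complex_norm_square)
qed

lemma norm_scalar_mult_vec: "norm (a *s x) = norm a * norm x" for x :: "complex ^ 'n"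
  by (simp add: norm_vec_def norm_mult L2_set_right_distrib)

text \<open>A coarse form of Cauchy-Schwarz, from |u_i| <= |u|. The second factor depends on
  \<open>x\<close> alone and acts as a constant when \<open>u\<close> varies with the spectral
  parameter.\<close>

lemma norm_herm_inner_le: "norm (herm_inner u x) \<le> norm u * (\<Sum>i\<in>UNIV. norm (x $ i))"
proof -
  have "norm (herm_inner u x) \<le> (\<Sum>i\<in>UNIV. norm (u $ i) * norm (x $ i))"
    unfolding herm_inner_def by (rule sum_norm_le) (simp add: norm_mult)
  also have "\<dots> \<le> (\<Sum>i\<in>UNIV. norm u * norm (x $ i))"
    by (intro sum_mono mult_right_mono Finite_Cartesian_Product.norm_nth_le) auto
  finally show ?thesis
    by (simp add: sum_distrib_left)
qed

lemma herm_inner_conj_transpose: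
  "herm_inner (conj_transpose A *v x) y = herm_inner x (A *v y)"
  unfolding herm_inner_def conj_transpose_def matrix_vector_mult_def
  apply (simp add: sum_distrib_left sum_distrib_right cnj_sum)
  apply (subst sum.swap)
  apply (simp add: mult_ac)
  done

text \<open>With A^H the conjugate transpose, <A^H x, x> is the conjugate of <A x, x>, so averaging
  the two leaves the real part.\<close>

lemma herm_inner_matrix_Re:
  "herm_inner (matrix_Re A *v x) x = of_real (Re (herm_inner (A *v x) x))"
proof -
  have "matrix_Re A *v x = (1/2) *s ((A + conj_transpose A) *v x)"
    by (simp add: vec_eq_iff matrix_Re_def matrix_vector_mult_def sum_distrib_left)
  then have "herm_inner (matrix_Re A *v x) x
      = (1/2) * (herm_inner (A *v x) x + cnj (herm_inner (A *v x) x))"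
    by (simp only: herm_inner_scale_left herm_inner_add_left herm_inner_conj_transpose
        matrix_vector_mult_add_rdistrib herm_inner_commute[of x])
  then show ?thesis
    by (simp add: complex_eq_iff)
qed

lemma herm_inner_matrix_Im:
  "herm_inner (matrix_Im A *v x) x = of_real (Im (herm_inner (A *v x) x))"
proof -
  have "matrix_Im A *v x = (1/(2*\<i>)) *s ((A - conj_transpose A) *v x)"
    by (simp add: vec_eq_iff matrix_Im_def matrix_vector_mult_def sum_distrib_left
        sum_negf[symmetric] mult.assoc del: sum_negf)
  then have "herm_inner (matrix_Im A *v x) x
      = (1/(2*\<i>)) * (herm_inner (A *v x) x - cnj (herm_inner (A *v x) x))"
    by (simp only: herm_inner_scale_left herm_inner_diff_left herm_inner_conj_transpose
        matrix_vector_mult_diff_rdistrib herm_inner_commute[of x])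
  then show ?thesis
    by (simp add: complex_eq_iff complex_diff_cnj)
qed

lemma accretive_dissipative_iff_unit:
  "accretive_dissipative A \<longleftrightarrow>
     (\<forall>x. norm x = 1 \<longrightarrow> 0 < Re (herm_inner (A *v x) x) \<and> 0 < Im (herm_inner (A *v x) x))"
  unfolding accretive_dissipative_def pos_definite_def numerical_range_def
    herm_inner_matrix_Re herm_inner_matrix_Im by auto

text \<open>Normalising \<open>x\<close> multiplies the quadratic form by the positive number 1 /
  |x|^2, which preserves both signs.\<close>

lemma accretive_dissipative_iff:
  fixes A :: "complex ^ 'n ^ 'n"
  shows "accretive_dissipative A \<longleftrightarrow>
     (\<forall>x. x \<noteq> 0 \<longrightarrow> 0 < Re (herm_inner (A *v x) x) \<and> 0 < Im (herm_inner (A *v x) x))"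
proof
  have scale: "0 < Re (herm_inner (A *v x) x) \<and> 0 < Im (herm_inner (A *v x) x)"
    if unit: "\<forall>x. norm x = 1 \<longrightarrow> 0 < Re (herm_inner (A *v x) x) \<and> 0 < Im (herm_inner (A *v x) x)"
      and "x \<noteq> 0" for x
  proof -
    define y where "y = of_real (1 / norm x) *s x"
    have "norm y = 1"
      using \<open>x \<noteq> 0\<close> by (simp add: y_def norm_scalar_mult_vec norm_divide)
    then have "0 < Re (herm_inner (A *v y) y)" "0 < Im (herm_inner (A *v y) y)"
      using unit by auto
    moreover have "herm_inner (A *v y) y = of_real ((1 / norm x)\<^sup>2) * herm_inner (A *v x) x"
      by (simp add: y_def vector_scalar_commute herm_inner_scale_left
          herm_inner_scale_right power2_eq_square)
    ultimately show ?thesis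
      using \<open>x \<noteq> 0\<close> by (simp add: zero_less_mult_iff zero_less_divide_iff)
  qed
  show "\<forall>x. x \<noteq> 0 \<longrightarrow> 0 < Re (herm_inner (A *v x) x) \<and> 0 < Im (herm_inner (A *v x) x)"
    if "accretive_dissipative A"
    using scale that unfolding accretive_dissipative_iff_unit by blast
  show "accretive_dissipative A"
    if "\<forall>x. x \<noteq> 0 \<longrightarrow> 0 < Re (herm_inner (A *v x) x) \<and> 0 < Im (herm_inner (A *v x) x)"
    unfolding accretive_dissipative_iff_unit
  proof (intro allI impI)
    fix x :: "complex ^ 'n" assume "norm x = 1"
    then have "x \<noteq> 0" by auto
    then show "0 < Re (herm_inner (A *v x) x) \<and> 0 < Im (herm_inner (A *v x) x)"
      using that by blast
  qed
qed

subsection \<open>The resolvent\<close>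

lemma mat_mult_vec: "mat z *v x = z *s x" for x :: "'a::comm_ring_1 ^ 'n"
  by (simp add: vec_eq_iff mat_def matrix_vector_mult_def if_distrib if_distribR cong: if_cong)

text \<open>A square matrix is invertible iff its kernel is trivial.\<close>

lemma resolvent_set_iff_not_eigenvalue: "z \<in> resolvent_set A \<longleftrightarrow> z \<notin> matrix_eigenvalues A"
  unfolding resolvent_set_def matrix_eigenvalues_def mem_Collect_eq invertible_left_inverse
    matrix_left_invertible_ker matrix_vector_mult_diff_rdistrib mat_mult_vec right_minus_eq
  by auto

lemma matrix_mult_inverse:
  assumes "invertible (M :: 'a::field ^ 'n ^ 'n)"
  shows "M ** matrix_inv M = mat 1"
proof -
  have "\<exists>N. M ** N = mat 1 \<and> N ** M = mat 1"
    using assms by (simp add: invertible_def)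
  then show ?thesis
    unfolding matrix_inv_def by (rule someI2_ex) blast
qed

lemma resolvent_eq:
  assumes "z \<in> resolvent_set A"
  shows "z *s (matrix_inv (mat z - A) *v v) - A *v (matrix_inv (mat z - A) *v v) = v"
proof -
  have "(mat z - A) *v (matrix_inv (mat z - A) *v v) = v"
    using assms by (simp add: resolvent_set_def matrix_vector_mul_assoc matrix_mult_inverse)
  then show ?thesis
    by (simp add: matrix_vector_mult_diff_rdistrib mat_mult_vec)
qed

text \<open>Two solutions differ by a vector in the kernel of zI - A, which is trivial on the
  resolvent set. Resolvent vectors can thus be identified by checking an equation.\<close>

lemma resolvent_unique:
  assumes "z \<in> resolvent_set A" "z *s u - A *v u = v"
  shows "matrix_inv (mat z - A) *v v = u"
proof -
  let ?w = "matrix_inv (mat z - A) *v v"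
  have "A *v (?w - u) = z *s (?w - u)"
    using resolvent_eq[OF assms(1), of v] assms(2)
    by (simp add: matrix_vector_mult_diff_distrib vector_ssub_ldistrib algebra_simps)
  then show ?thesis
    using assms(1) unfolding resolvent_set_iff_not_eigenvalue matrix_eigenvalues_def mem_Collect_eq
    by (meson right_minus_eq)
qed

lemma holomorphic_on_det:
  fixes M :: "complex \<Rightarrow> complex ^ 'n ^ 'n"
  assumes "\<And>i j. (\<lambda>z. M z $ i $ j) holomorphic_on S"
  shows "(\<lambda>z. det (M z)) holomorphic_on S"
  unfolding det_def using assms by (intro holomorphic_intros) auto

lemma holomorphic_mat_diff: "(\<lambda>z. (mat z - A) $ i $ j) holomorphic_on S"
  by (cases "i = j") (auto simp: mat_def intro!: holomorphic_intros)

text \<open>By Cramer's rule each coordinate is a quotient of two determinants whose entries are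
  constant or affine in \<open>z\<close>; the denominator vanishes only at eigenvalues.\<close>

lemma holomorphic_resolvent: "(\<lambda>z. (matrix_inv (mat z - A) *v v) $ k) holomorphic_on resolvent_set A"
proof -
  have nz: "det (mat z - A) \<noteq> 0" if "z \<in> resolvent_set A" for z
    using that by (simp add: resolvent_set_def invertible_det_nz)
  have eq: "(matrix_inv (mat z - A) *v v) $ k
      = det (\<chi> i j. if j = k then v $ i else (mat z - A) $ i $ j) / det (mat z - A)"
    if "z \<in> resolvent_set A" for z
  proof -
    have "(mat z - A) *v (matrix_inv (mat z - A) *v v) = v"
      using resolvent_eq[OF that] by (simp add: matrix_vector_mult_diff_rdistrib mat_mult_vec)
    then show ?thesis
      unfolding cramer[OF nz[OF that]] by (simp only: vec_lambda_beta)
  qed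
  have "(\<lambda>z. (\<chi> i j. if j = k then v $ i else (mat z - A) $ i $ j) $ i $ j) holomorphic_on S"
    for i j S
    using holomorphic_mat_diff[of A i j S] by (cases "j = k") auto
  then have "(\<lambda>z. det (\<chi> i j. if j = k then v $ i else (mat z - A) $ i $ j) / det (mat z - A))
      holomorphic_on resolvent_set A"
    by (intro holomorphic_on_divide holomorphic_on_det holomorphic_mat_diff nz)
  then show ?thesis
    by (rule holomorphic_transform) (simp add: eq)
qed

lemma holomorphic_resolvent_entry:
  "(\<lambda>z. matrix_inv (mat z - A) $ i $ j) holomorphic_on resolvent_set A"
proof (rule holomorphic_transform[OF holomorphic_resolvent])
  show "(matrix_inv (mat z - A) *v axis j 1) $ i = matrix_inv (mat z - A) $ i $ j" for z
    by (simp add: matrix_vector_mult_def axis_def if_distrib cong: if_cong)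
qed

text \<open>The vectors \<open>v\<close> and \<open>x\<close> are kept apart because the resolvent
  identity replaces \<open>v\<close> by another resolvent vector while \<open>x\<close> stays
  fixed.\<close>

definition resolvent_form :: "complex ^ 'n ^ 'n \<Rightarrow> complex ^ 'n \<Rightarrow> complex ^ 'n \<Rightarrow> complex \<Rightarrow> complex" where
  "resolvent_form A v x z = herm_inner (matrix_inv (mat z - A) *v v) x"

lemma holomorphic_resolvent_form: "resolvent_form A v x holomorphic_on resolvent_set A"
proof -
  have "(\<lambda>z. \<Sum>k\<in>UNIV. (matrix_inv (mat z - A) *v v) $ k * cnj (x $ k)) holomorphic_on resolvent_set A"
    by (intro holomorphic_intros holomorphic_resolvent)
  then show ?thesis
    by (rule holomorphic_transform) (simp add: resolvent_form_def herm_inner_def)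
qed

text \<open>The first resolvent identity R(z) - R(w) = (w - z) R(z) R(w), tested against
  \<open>x\<close>.\<close>

lemma resolvent_identity:
  assumes "z \<in> resolvent_set A" "w \<in> resolvent_set A"
  shows "resolvent_form A v x z - resolvent_form A v x w
       = (w - z) * resolvent_form A (matrix_inv (mat w - A) *v v) x z"
proof -
  let ?u = "matrix_inv (mat z - A) *v v" and ?y = "matrix_inv (mat w - A) *v v"
  let ?p = "matrix_inv (mat z - A) *v ?y"
  have "matrix_inv (mat z - A) *v v = ?y + (w - z) *s ?p"
  proof (rule resolvent_unique[OF assms(1)])
    have "A *v ?y = w *s ?y - v" "A *v ?p = z *s ?p - ?y"
      using resolvent_eq[OF assms(2), of v] resolvent_eq[OF assms(1), of ?y]
      by (simp_all add: algebra_simps)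
    then have "A *v (?y + (w - z) *s ?p) = (w *s ?y - v) + (w - z) *s (z *s ?p - ?y)"
      by (simp only: matrix_vector_right_distrib vector_scalar_commute)
    then show "z *s (?y + (w - z) *s ?p) - A *v (?y + (w - z) *s ?p) = v"
      by (simp add: vec_eq_iff algebra_simps)
  qed
  then show ?thesis
    unfolding resolvent_form_def by (simp only: herm_inner_add_left herm_inner_scale_left) simp
qed

subsection \<open>A circular contour\<close>

text \<open>By the residue theorem the integral depends on the curve only through its winding
  numbers about \<open>P\<close>. This serves both to replace the contour of
  \<open>frac_power\<close> and to change the radius of a circle.\<close>

lemma contour_integral_eq_if_winding_number_eq:
  assumes S: "open S" "connected S" and "finite P" and holo: "f holomorphic_on S - P"
    and g: "valid_path g" "pathfinish g = pathstart g" "path_image g \<subseteq> S - P"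
      "\<And>z. z \<notin> S \<Longrightarrow> winding_number g z = 0"
    and h: "valid_path h" "pathfinish h = pathstart h" "path_image h \<subseteq> S - P"
      "\<And>z. z \<notin> S \<Longrightarrow> winding_number h z = 0"
    and eq: "\<And>p. p \<in> P \<Longrightarrow> winding_number g p = winding_number h p"
  shows "contour_integral g f = contour_integral h f"
proof -
  have "contour_integral g f = 2 * pi * \<i> * (\<Sum>p\<in>P. winding_number g p * residue f p)"
    using g by (intro Residue_theorem[OF S \<open>finite P\<close> holo]) auto
  also have "\<dots> = 2 * pi * \<i> * (\<Sum>p\<in>P. winding_number h p * residue f p)"
    using eq by simp
  also have "\<dots> = contour_integral h f"
    using h by (intro Residue_theorem[OF S \<open>finite P\<close> holo, symmetric]) auto
  finally show ?thesis .
qed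

lemma slit_plane_eq: "- \<real>\<^sub>\<le>\<^sub>0 = - (complex_of_real ` {..0})"
  by (auto simp: nonpos_Reals_def)

text \<open>The slit plane is simply connected and \<open>z\<close> lies outside it.\<close>

lemma winding_number_slit_plane:
  assumes "path g" "pathfinish g = pathstart g" "path_image g \<subseteq> - \<real>\<^sub>\<le>\<^sub>0" "z \<in> \<real>\<^sub>\<le>\<^sub>0"
  shows "winding_number g z = 0"
proof (rule simply_connected_imp_winding_number_zero)
  show "simply_connected (- \<real>\<^sub>\<le>\<^sub>0 :: complex set)"
    unfolding slit_plane_eq by (rule simply_connected_slotted_complex_plane_left)
qed (use assms in auto)

text \<open>The contraction bound says that A - cI has operator norm at most \<rho>, so the spectrum
  lies within \<rho> of \<open>c\<close>. The circle of radius \<open>r\<close> encloses it with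
  room to spare and, as \<open>r < c\<close>, stays in the right half-plane.\<close>

locale resolvent_disc =
  fixes A :: "complex ^ 'n ^ 'n" and c r \<rho> :: real
  assumes rho_nonneg: "0 \<le> \<rho>" and rho_less: "\<rho> < r" and r_less: "r < c"
    and contraction: "\<And>v. norm (A *v v - of_real c *s v) \<le> \<rho> * norm v"
begin

lemma r_pos: "0 < r"
  using rho_nonneg rho_less by simp

text \<open>Reverse triangle inequality for zI - A = (z - c)I - (A - cI). It yields both
  invertibility and the resolvent bound.\<close>

lemma norm_resolvent_eq_lower:
  "(norm (z - of_real c) - \<rho>) * norm v \<le> norm (z *s v - A *v v)"
proof -
  have "z *s v - A *v v = (z - of_real c) *s v - (A *v v - of_real c *s v)"
    by (simp add: vec_eq_iff algebra_simps)
  then have "norm ((z - of_real c) *s v) - norm (A *v v - of_real c *s v) \<le> norm (z *s v - A *v v)"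
    by (simp only: norm_triangle_ineq2)
  then show ?thesis
    using contraction[of v] unfolding norm_scalar_mult_vec left_diff_distrib by linarith
qed

lemma mem_resolvent_set:
  assumes "\<rho> < norm (z - of_real c)"
  shows "z \<in> resolvent_set A"
proof -
  have "v = 0" if "A *v v = z *s v" for v
  proof -
    have "(norm (z - of_real c) - \<rho>) * norm v \<le> 0"
      using norm_resolvent_eq_lower[of z v] that by simp
    then show ?thesis
      using assms by (simp add: mult_le_0_iff)
  qed
  then show ?thesis
    unfolding resolvent_set_iff_not_eigenvalue matrix_eigenvalues_def by blast
qed

lemma norm_resolvent_le:
  assumes "\<rho> < norm (z - of_real c)"
  shows "norm (matrix_inv (mat z - A) *v v) \<le> norm v / (norm (z - of_real c) - \<rho>)"
  using norm_resolvent_eq_lower[of z "matrix_inv (mat z - A) *v v"]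
    resolvent_eq[OF mem_resolvent_set[OF assms], of v] assms
  by (simp add: pos_le_divide_eq mult.commute)

lemma eigenvalues_in_disc: "z \<in> matrix_eigenvalues A \<Longrightarrow> norm (z - of_real c) \<le> \<rho>"
  using mem_resolvent_set resolvent_set_iff_not_eigenvalue by (meson not_le)

text \<open>Eigenvalues are the zeros of det(zI - A) and lie in a compact disc. The determinant is
  nonzero at \<open>c + r\<close>, so if it is constant there are no zeros, and otherwise the zeros
  in the disc are finite in number.\<close>

lemma finite_eigenvalues: "finite (matrix_eigenvalues A)"
proof -
  let ?D = "\<lambda>z. det (mat z - A)"
  have zero: "z \<in> matrix_eigenvalues A \<longleftrightarrow> ?D z = 0" for z
    by (metis invertible_det_nz mem_Collect_eq resolvent_set_def resolvent_set_iff_not_eigenvalue)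
  have "\<rho> < norm (of_real (c + r) - complex_of_real c)"
    using rho_nonneg rho_less by simp
  then have nz: "?D (of_real (c + r)) \<noteq> 0"
    using mem_resolvent_set resolvent_set_iff_not_eigenvalue zero by blast
  show ?thesis
  proof (cases "?D constant_on UNIV")
    case True
    then have "matrix_eigenvalues A = {}"
      using zero nz by (auto simp: constant_on_def)
    then show ?thesis by simp
  next
    case False
    then have "finite {z \<in> cball (of_real c) \<rho>. ?D z = 0}"
      by (intro holomorphic_compact_finite_zeros[where S = UNIV] holomorphic_on_det
          holomorphic_mat_diff) auto
    moreover have "matrix_eigenvalues A \<subseteq> {z \<in> cball (of_real c) \<rho>. ?D z = 0}"
      using zero eigenvalues_in_disc by (auto simp: dist_norm norm_minus_commute)
    ultimately show ?thesis
      by (rule finite_subset[rotated])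
  qed
qed

lemma sphere_subset_resolvent_set: "r \<le> R \<Longrightarrow> sphere (of_real c) R \<subseteq> resolvent_set A"
  using rho_less by (auto intro!: mem_resolvent_set simp: dist_norm norm_minus_commute)

lemma Re_pos_if_mem_disc: "z \<in> cball (of_real c) r \<Longrightarrow> 0 < Re z"
  using abs_Re_le_cmod[of "z - of_real c"] r_less by (auto simp: dist_norm norm_minus_commute)

lemma disc_subset_slit_plane: "cball (complex_of_real c) r \<subseteq> - \<real>\<^sub>\<le>\<^sub>0"
proof
  show "z \<in> - \<real>\<^sub>\<le>\<^sub>0" if "z \<in> cball (complex_of_real c) r" for z
    using Re_pos_if_mem_disc[OF that] by (simp add: complex_nonpos_Reals_iff)
qed

lemma power_contour_circlepath: "power_contour A (circlepath (of_real c) r)"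
  unfolding power_contour_def
proof (intro conjI ballI)
  show "path_image (circlepath (of_real c) r) \<subseteq> resolvent_set A - \<real>\<^sub>\<le>\<^sub>0"
    using sphere_subset_resolvent_set[of r] disc_subset_slit_plane r_pos by auto
  show "winding_number (circlepath (of_real c) r) z = 1" if "z \<in> matrix_eigenvalues A" for z
    using eigenvalues_in_disc[OF that] rho_less by (intro winding_number_circlepath) simp
qed auto

text \<open>Admissible contours wind once about each eigenvalue and, staying in the slit plane, not
  at all about points of the cut, so the residue sums agree.\<close>

lemma contour_integral_power_contour:
  assumes g: "power_contour A g" and h: "power_contour A h"
    and holo: "f holomorphic_on resolvent_set A - \<real>\<^sub>\<le>\<^sub>0"
  shows "contour_integral g f = contour_integral h f"
proof (rule contour_integral_eq_if_winding_number_eq[where S = "- \<real>\<^sub>\<le>\<^sub>0" and P = "matrix_eigenvalues A"])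
  have eq: "- \<real>\<^sub>\<le>\<^sub>0 - matrix_eigenvalues A = resolvent_set A - \<real>\<^sub>\<le>\<^sub>0"
    by (auto simp: resolvent_set_iff_not_eigenvalue)
  show "f holomorphic_on - \<real>\<^sub>\<le>\<^sub>0 - matrix_eigenvalues A"
    "path_image g \<subseteq> - \<real>\<^sub>\<le>\<^sub>0 - matrix_eigenvalues A" "path_image h \<subseteq> - \<real>\<^sub>\<le>\<^sub>0 - matrix_eigenvalues A"
    using g h holo unfolding eq power_contour_def by auto
  show "connected (- \<real>\<^sub>\<le>\<^sub>0 :: complex set)"
    unfolding slit_plane_eq
    by (rule simply_connected_imp_connected[OF simply_connected_slotted_complex_plane_left])
  show "open (- \<real>\<^sub>\<le>\<^sub>0 :: complex set)"
    using closed_nonpos_Reals_complex by auto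
  show "winding_number g z = 0" "winding_number h z = 0" if "z \<notin> - \<real>\<^sub>\<le>\<^sub>0" for z
    using g h that unfolding power_contour_def
    by (auto intro!: winding_number_slit_plane valid_path_imp_path)
qed (use g h finite_eigenvalues in \<open>auto simp: power_contour_def\<close>)

text \<open>\<open>SOME\<close> picks an unspecified contour. The circle shows that an admissible
  one exists, and contour independence lets the circle take its place.\<close>

lemma frac_power_circlepath:
  "frac_power A t $ i $ j = 1 / (2 * of_real pi * \<i>) *
     contour_integral (circlepath (of_real c) r)
       (\<lambda>z. z powr of_real t * matrix_inv (mat z - A) $ i $ j)"
proof -
  have "(\<lambda>z. z powr of_real t * matrix_inv (mat z - A) $ i $ j)
      holomorphic_on resolvent_set A - \<real>\<^sub>\<le>\<^sub>0"
    by (intro holomorphic_intros holomorphic_on_subset[OF holomorphic_resolvent_entry]) auto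
  moreover have "power_contour A (SOME \<gamma>. power_contour A \<gamma>)"
    using power_contour_circlepath by (rule someI[where P = "power_contour A"])
  ultimately show ?thesis
    unfolding frac_power_def Let_def vec_lambda_beta
    by (simp only: contour_integral_power_contour[OF _ power_contour_circlepath])
qed

lemma contour_integrable_circlepath:
  assumes "f holomorphic_on resolvent_set A - \<real>\<^sub>\<le>\<^sub>0"
  shows "f contour_integrable_on circlepath (of_real c) r"
proof (rule contour_integrable_continuous_circlepath)
  have "sphere (of_real c) r \<subseteq> resolvent_set A - \<real>\<^sub>\<le>\<^sub>0"
    using power_contour_circlepath r_pos by (auto simp: power_contour_def)
  then show "continuous_on (path_image (circlepath (of_real c) r)) f"
    using assms r_pos by (auto intro: holomorphic_on_imp_continuous_on holomorphic_on_subset)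
qed

lemma herm_inner_frac_power:
  "herm_inner (frac_power A t *v x) x = 1 / (2 * of_real pi * \<i>) *
     contour_integral (circlepath (of_real c) r) (\<lambda>z. z powr of_real t * resolvent_form A x x z)"
proof -
  let ?C = "circlepath (of_real c) r"
  let ?f = "\<lambda>i j z. z powr of_real t * matrix_inv (mat z - A) $ i $ j"
  have holo: "?f i j holomorphic_on resolvent_set A - \<real>\<^sub>\<le>\<^sub>0" for i j
    by (intro holomorphic_intros holomorphic_on_subset[OF holomorphic_resolvent_entry]) auto
  have int: "(\<lambda>z. ?f i j z * (x $ j * cnj (x $ i))) contour_integrable_on ?C" for i j
    by (intro contour_integrable_circlepath holomorphic_intros holo)
  have "contour_integral ?C (\<lambda>z. z powr of_real t * resolvent_form A x x z)
      = contour_integral ?C (\<lambda>z. \<Sum>i\<in>UNIV. \<Sum>j\<in>UNIV. ?f i j z * (x $ j * cnj (x $ i)))"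
    by (rule arg_cong[where f = "contour_integral ?C"])
      (simp add: fun_eq_iff resolvent_form_def herm_inner_def matrix_vector_mult_def
        sum_distrib_left sum_distrib_right mult_ac)
  also have "\<dots> = (\<Sum>i\<in>UNIV. \<Sum>j\<in>UNIV. contour_integral ?C (?f i j) * (x $ j * cnj (x $ i)))"
    by (simp add: contour_integral_sum contour_integrable_sum int contour_integral_rmul
        contour_integrable_circlepath holo)
  finally show ?thesis
    by (simp add: herm_inner_def matrix_vector_mult_def frac_power_circlepath
        sum_distrib_left sum_distrib_right mult_ac)
qed

section \<open>Cauchy integrals of the resolvent form\<close>

lemma resolvent_form_integrable:
  assumes "r \<le> R"
  shows "resolvent_form A v x contour_integrable_on circlepath (of_real c) R"
  using sphere_subset_resolvent_set[OF assms] r_pos assms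
  by (intro contour_integrable_continuous_circlepath
      continuous_on_subset[OF holomorphic_on_imp_continuous_on[OF holomorphic_resolvent_form]]) auto

text \<open>Without the factor z^t there is no cut to avoid, so circles of arbitrarily large radius
  about \<open>c\<close> are allowed; all of them enclose every eigenvalue.\<close>

lemma contour_integral_resolvent_form_radius:
  assumes "r \<le> R"
  shows "contour_integral (circlepath (of_real c) R) (resolvent_form A v x)
       = contour_integral (circlepath (of_real c) r) (resolvent_form A v x)"
proof (rule contour_integral_eq_if_winding_number_eq[where S = UNIV and P = "matrix_eigenvalues A"])
  have eq: "UNIV - matrix_eigenvalues A = resolvent_set A"
    by (auto simp: resolvent_set_iff_not_eigenvalue)
  show "resolvent_form A v x holomorphic_on UNIV - matrix_eigenvalues A"
    "path_image (circlepath (of_real c) R) \<subseteq> UNIV - matrix_eigenvalues A"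
    "path_image (circlepath (of_real c) r) \<subseteq> UNIV - matrix_eigenvalues A"
    using sphere_subset_resolvent_set[of r] sphere_subset_resolvent_set[OF assms] r_pos assms
    unfolding eq by (auto simp: holomorphic_resolvent_form)
  show "winding_number (circlepath (of_real c) R) p = winding_number (circlepath (of_real c) r) p"
    if "p \<in> matrix_eigenvalues A" for p
    using eigenvalues_in_disc[OF that] rho_less assms by (simp add: winding_number_circlepath)
qed (use finite_eigenvalues in auto)

text \<open>With u = R(z)v one has (z - c)u = v + (A - cI)u. The remainder is therefore <(A - cI)u,
  x> / (z - c), and u itself is of size |v| / (R - \<rho>).\<close>

lemma norm_resolvent_form_remainder_le:
  assumes "norm (z - of_real c) = R" "r \<le> R"
  shows "norm (resolvent_form A v x z - herm_inner v x / (z - of_real c))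
       \<le> \<rho> * norm v * (\<Sum>i\<in>UNIV. norm (x $ i)) / (R * (R - \<rho>))"
proof -
  define u where "u = matrix_inv (mat z - A) *v v"
  have R: "\<rho> < R" "0 < R" and zc: "z \<noteq> of_real c"
    using assms rho_less r_pos by auto
  have u: "z *s u - A *v u = v"
    unfolding u_def using assms R by (intro resolvent_eq mem_resolvent_set) simp
  have "(z - of_real c) * herm_inner u x - herm_inner v x = herm_inner (A *v u - of_real c *s u) x"
    unfolding u[symmetric] by (simp add: herm_inner_diff_left herm_inner_scale_left algebra_simps)
  then have eq: "resolvent_form A v x z - herm_inner v x / (z - of_real c)
      = herm_inner (A *v u - of_real c *s u) x / (z - of_real c)"
    using zc by (simp add: resolvent_form_def u_def[symmetric] field_simps)
  have "norm u \<le> norm v / (R - \<rho>)"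
    using norm_resolvent_le[of z v] assms R by (simp add: u_def)
  then have "norm (A *v u - of_real c *s u) \<le> \<rho> * (norm v / (R - \<rho>))"
    by (intro order_trans[OF contraction] mult_left_mono rho_nonneg)
  then have "norm (herm_inner (A *v u - of_real c *s u) x)
      \<le> \<rho> * (norm v / (R - \<rho>)) * (\<Sum>i\<in>UNIV. norm (x $ i))"
    by (intro order_trans[OF norm_herm_inner_le] mult_right_mono sum_nonneg) auto
  then have "norm (resolvent_form A v x z - herm_inner v x / (z - of_real c))
      \<le> \<rho> * (norm v / (R - \<rho>)) * (\<Sum>i\<in>UNIV. norm (x $ i)) / R"
    unfolding eq norm_divide assms(1) using R by (intro divide_right_mono) auto
  then show ?thesis
    by (simp add: mult.commute)
qed

text \<open>The integral does not depend on the radius, and the remainder is \<open>O(R\<^sup>-\<^sup>2)\<close> on the circle of radius \<open>R\<close>.\<close>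

lemma contour_integral_resolvent_form:
  "contour_integral (circlepath (of_real c) r) (resolvent_form A v x) = 2 * of_real pi * \<i> * herm_inner v x"
proof (rule ccontr)
  assume neq: "\<not> ?thesis"
  define D where "D = contour_integral (circlepath (of_real c) r) (resolvent_form A v x)
    - 2 * of_real pi * \<i> * herm_inner v x"
  define K where "K = \<rho> * norm v * (\<Sum>i\<in>UNIV. norm (x $ i))"
  have K: "0 \<le> K"
    unfolding K_def using rho_nonneg by (intro mult_nonneg_nonneg sum_nonneg) auto
  have D: "0 < norm D"
    using neq by (simp add: D_def)
  have bound: "norm D * (R - \<rho>) \<le> 2 * pi * K" if "r \<le> R" for R
  proof -
    have R: "\<rho> < R" "0 < R"
      using that rho_less r_pos by auto
    have "(resolvent_form A v x has_contour_integral
        contour_integral (circlepath (of_real c) r) (resolvent_form A v x)) (circlepath (of_real c) R)"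
      using has_contour_integral_integral[OF resolvent_form_integrable[OF that]]
      by (simp add: contour_integral_resolvent_form_radius[OF that])
    moreover have "((\<lambda>z. herm_inner v x / (z - of_real c)) has_contour_integral
        2 * of_real pi * \<i> * herm_inner v x) (circlepath (of_real c) R)"
      using Cauchy_integral_circlepath_simple[of "\<lambda>_. herm_inner v x" "of_real c" R "of_real c"] R
      by simp
    ultimately have "((\<lambda>z. resolvent_form A v x z - herm_inner v x / (z - of_real c))
        has_contour_integral D) (circlepath (of_real c) R)"
      unfolding D_def by (rule has_contour_integral_diff)
    then have "norm D \<le> K / (R * (R - \<rho>)) * (2 * pi * R)"
      using norm_resolvent_form_remainder_le[OF _ that] R K
      by (intro has_contour_integral_bound_circlepath) (auto simp: K_def)
    also have "\<dots> = 2 * pi * K / (R - \<rho>)"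
      using R by (simp add: field_simps)
    finally show ?thesis
      using R by (simp add: pos_le_divide_eq)
  qed
  \<comment> \<open>This radius turns the left side into 2 pi K plus the positive amount |D| (r -
    \<rho>), contradicting the bound.\<close>
  have "norm D * (r + 2 * pi * K / norm D - \<rho>) \<le> 2 * pi * K"
    using K by (intro bound) simp
  moreover have "norm D * (r + 2 * pi * K / norm D - \<rho>) = norm D * (r - \<rho>) + 2 * pi * K"
    using D by (simp add: algebra_simps)
  moreover have "0 < norm D * (r - \<rho>)"
    using D rho_less by simp
  ultimately show False
    by linarith
qed

text \<open>Dividing the resolvent identity by z - w splits the integrand into a constant over z -
  w, with integral 0 as \<open>w\<close> lies outside the circle, and a resolvent form for R(w)v,
  whose integral is known.\<close>

lemma contour_integral_resolvent_form_Cauchy: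
  assumes w: "r < norm (w - of_real c)"
  shows "contour_integral (circlepath (of_real c) r) (\<lambda>z. resolvent_form A v x z / (z - w))
       = - 2 * of_real pi * \<i> * resolvent_form A v x w"
proof -
  let ?C = "circlepath (of_real c) r" and ?y = "matrix_inv (mat w - A) *v v"
  have wres: "w \<in> resolvent_set A"
    using w rho_less by (intro mem_resolvent_set) simp
  have "((\<lambda>z. 1 / (z - w)) has_contour_integral 0) ?C"
  proof (rule Cauchy_theorem_disc_simple[where a = "of_real c" and e = "norm (w - of_real c)"])
    show "(\<lambda>z. 1 / (z - w)) holomorphic_on ball (of_real c) (cmod (w - of_real c))"
      by (intro holomorphic_intros) (auto simp: dist_norm norm_minus_commute)
  qed (use w r_pos in auto)
  then have "((\<lambda>z. resolvent_form A v x w * (1 / (z - w)) - resolvent_form A ?y x z)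
      has_contour_integral resolvent_form A v x w * 0 - 2 * of_real pi * \<i> * herm_inner ?y x) ?C"
    using has_contour_integral_integral[OF resolvent_form_integrable[OF order_refl, of ?y x]]
    unfolding contour_integral_resolvent_form
    by (intro has_contour_integral_diff has_contour_integral_lmul)
  then have "((\<lambda>z. resolvent_form A v x z / (z - w))
      has_contour_integral resolvent_form A v x w * 0 - 2 * of_real pi * \<i> * herm_inner ?y x) ?C"
  proof (rule has_contour_integral_eq)
    fix z assume "z \<in> path_image ?C"
    then have z: "norm (z - of_real c) = r"
      using r_pos by (auto simp: dist_norm norm_minus_commute)
    then have "z \<in> resolvent_set A" "z \<noteq> w"
      using w rho_less by (auto intro: mem_resolvent_set)
    then show "resolvent_form A v x w * (1 / (z - w)) - resolvent_form A ?y x z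
        = resolvent_form A v x z / (z - w)"
      using resolvent_identity[OF _ wres, of z v x] by (simp add: field_simps)
  qed
  then show ?thesis
    by (simp add: contour_integral_unique resolvent_form_def)
qed

end

subsection \<open>Truncated integral representation of the power function\<close>

text \<open>Over (0, \<infinity>) this integral would be pi / sin(pi t) times z^t; the normalising
  constant is left out. The complex \<open>powr\<close> lets the integrand be read along a complex
  segment when integrals are exchanged.\<close>

definition truncated_power :: "real \<Rightarrow> real \<Rightarrow> real \<Rightarrow> complex \<Rightarrow> complex" where
  "truncated_power t a b z =
     integral {a..b} (\<lambda>s. of_real s powr of_real (t - 1) * (z / (of_real s + z)))"

lemma add_of_real_neq_0: "0 < s \<Longrightarrow> 0 < Re z \<Longrightarrow> of_real s + z \<noteq> 0"
  by (auto simp: complex_eq_iff)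

lemma continuous_on_kernel:
  assumes "0 < a" "\<And>z s. (z, s) \<in> S \<Longrightarrow> 0 < Re z \<and> a \<le> s"
  shows "continuous_on S (\<lambda>(z, s). of_real s powr of_real (t - 1) * (z / (of_real s + z)))"
    and "continuous_on S (\<lambda>(z, s). of_real s powr of_real (t - 1) * (of_real s / (of_real s + z)\<^sup>2))"
proof -
  have s: "0 < s" and nz: "of_real s + z \<noteq> 0" if "(z, s) \<in> S" for z s
    using assms(2)[OF that] assms(1) add_of_real_neq_0[of s z] by auto
  show "continuous_on S (\<lambda>(z, s). of_real s powr of_real (t - 1) * (z / (of_real s + z)))"
    and "continuous_on S (\<lambda>(z, s). of_real s powr of_real (t - 1) * (of_real s / (of_real s + z)\<^sup>2))"
    unfolding case_prod_beta by (auto intro!: continuous_intros dest: s nz)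
qed

text \<open>Differentiation under the integral sign on the right half-plane, which is convex for the
  Leibniz rule and open for the derivative at \<open>z\<close>.\<close>

lemma has_field_derivative_truncated_power:
  assumes "0 < a" "0 < Re z"
  shows "(truncated_power t a b has_field_derivative
      integral {a..b} (\<lambda>s. of_real s powr of_real (t - 1) * (of_real s / (of_real s + z)\<^sup>2))) (at z)"
proof -
  have convex: "convex {z. 0 < Re z}" and "open {z. 0 < Re z}"
    by (auto simp: convex_halfspace_Re_gt open_halfspace_Re_gt)
  have "((\<lambda>z. integral (cbox a b) (\<lambda>s. of_real s powr of_real (t - 1) * (z / (of_real s + z))))
      has_field_derivative
      integral (cbox a b) (\<lambda>s. of_real s powr of_real (t - 1) * (of_real s / (of_real s + z)\<^sup>2)))
      (at z within {z. 0 < Re z})"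
  proof (rule leibniz_rule_field_derivative[OF _ _ _ _ convex])
    show "((\<lambda>z. of_real s powr of_real (t - 1) * (z / (of_real s + z))) has_field_derivative
        of_real s powr of_real (t - 1) * (of_real s / (of_real s + z)\<^sup>2)) (at z within {z. 0 < Re z})"
      if "z \<in> {z. 0 < Re z}" "s \<in> cbox a b" for z s
    proof -
      have "of_real s + z \<noteq> 0"
        using that assms(1) by (intro add_of_real_neq_0) auto
      then show ?thesis
        by (auto intro!: derivative_eq_intros simp: field_simps power2_eq_square)
    qed
    show "(\<lambda>s. of_real s powr of_real (t - 1) * (z / (of_real s + z))) integrable_on cbox a b"
      if "z \<in> {z. 0 < Re z}" for z
    proof (rule integrable_continuous)
      have "continuous_on ({z} \<times> cbox a b)
          (\<lambda>(z, s). of_real s powr of_real (t - 1) * (z / (of_real s + z)))"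
        using that assms(1) by (intro continuous_on_kernel[OF assms(1)]) auto
      then have "continuous_on (cbox a b) ((\<lambda>(z, s). of_real s powr of_real (t - 1) * (z / (of_real s + z))) \<circ> Pair z)"
        by (intro continuous_on_compose continuous_intros) (auto elim: continuous_on_subset)
      then show "continuous_on (cbox a b) (\<lambda>s. of_real s powr of_real (t - 1) * (z / (of_real s + z)))"
        by (simp add: o_def)
    qed
    show "continuous_on ({z. 0 < Re z} \<times> cbox a b)
        (\<lambda>(z, s). of_real s powr of_real (t - 1) * (of_real s / (of_real s + z)\<^sup>2))"
      by (intro continuous_on_kernel[OF assms(1)]) auto
  qed (use assms in auto)
  then show ?thesis
    using \<open>open {z. 0 < Re z}\<close> assms(2)
    by (simp add: truncated_power_def[abs_def] at_within_open[of z "{z. 0 < Re z}"])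
qed

text \<open>The combined integrand is the derivative in \<open>s\<close> of s^t z / (s + z), so the
  fundamental theorem of calculus leaves only boundary terms.\<close>

lemma truncated_power_ode:
  assumes "0 < a" "a \<le> b" "0 < Re z"
  shows "of_real t * truncated_power t a b z
      - z * integral {a..b} (\<lambda>s. of_real s powr of_real (t - 1) * (of_real s / (of_real s + z)\<^sup>2))
      = of_real b powr of_real t * (z / (of_real b + z)) - of_real a powr of_real t * (z / (of_real a + z))"
proof -
  let ?k = "\<lambda>s. of_real s powr of_real (t - 1) * (z / (of_real s + z))"
  let ?l = "\<lambda>s. of_real s powr of_real (t - 1) * (of_real s / (of_real s + z)\<^sup>2)"
  have nz: "of_real s + z \<noteq> 0" "complex_of_real s \<noteq> 0" "complex_of_real s \<notin> \<real>\<^sub>\<le>\<^sub>0" if "s \<in> {a..b}" for s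
    using that assms add_of_real_neq_0[of s z] by auto
  have int: "?k integrable_on {a..b}" "?l integrable_on {a..b}"
    using assms(1) by (auto intro!: integrable_continuous_interval continuous_intros dest: nz)
  have "((\<lambda>s. of_real t * ?k s - z * ?l s) has_integral
      of_real b powr of_real t * (z / (of_real b + z)) - of_real a powr of_real t * (z / (of_real a + z))) {a..b}"
  proof (rule fundamental_theorem_of_calculus[OF assms(2)])
    fix s assume s: "s \<in> {a..b}"
    have "((\<lambda>s. s powr of_real t * (z / (s + z))) has_field_derivative
        of_real t * ?k s - z * ?l s) (at (of_real s))"
    proof -
      have "of_real s powr of_real t = of_real s powr of_real (t - 1) * complex_of_real s"
        using nz(2)[OF s] by (simp add: powr_diff)
      then have eq: "of_real t * ?k s - z * ?l s
          = (of_real t * of_real s powr (of_real t - 1)) * (z / (of_real s + z))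
            + - (z / (of_real s + z)\<^sup>2) * of_real s powr of_real t"
        by (simp add: mult_ac)
      have "((\<lambda>s. z / (s + z)) has_field_derivative - (z / (of_real s + z)\<^sup>2)) (at (of_real s))"
        using nz(1)[OF s] by (auto intro!: derivative_eq_intros simp: power2_eq_square)
      then show ?thesis
        unfolding eq using nz(3)[OF s] by (intro DERIV_mult has_field_derivative_powr)
    qed
    then show "((\<lambda>s. of_real s powr of_real t * (z / (of_real s + z))) has_vector_derivative
        of_real t * ?k s - z * ?l s) (at s within {a..b})"
      by (rule has_vector_derivative_real_field)
  qed
  moreover have "((\<lambda>s. of_real t * ?k s - z * ?l s) has_integral
      of_real t * integral {a..b} ?k - z * integral {a..b} ?l) {a..b}"
    by (intro has_integral_diff has_integral_mult_right integrable_integral int)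
  ultimately show ?thesis
    unfolding truncated_power_def by (rule has_integral_unique[rotated])
qed

lemma norm_of_real_add_ge:
  assumes "0 \<le> s" "0 \<le> Re z"
  shows "s \<le> norm (of_real s + z)" "norm z \<le> norm (of_real s + z)"
proof -
  show "s \<le> norm (of_real s + z)"
    using complex_Re_le_cmod[of "of_real s + z"] assms by simp
  have "(Re z)\<^sup>2 \<le> (s + Re z)\<^sup>2"
    using assms by (intro power_mono) auto
  then show "norm z \<le> norm (of_real s + z)"
    by (simp add: cmod_def)
qed

text \<open>The term at \<open>b\<close> is estimated by |b + z| >= b, the term at \<open>a\<close>
  by |a + z| >= |z|. For 0 < t < 1 both powers become small as a tends to 0 and b to
  \<infinity>.\<close>

lemma norm_boundary_terms_le:
  assumes "0 < a" "0 < b" "0 < Re z"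
  shows "norm (of_real b powr of_real t * (z / (of_real b + z)) - of_real a powr of_real t * (z / (of_real a + z)))
      \<le> (b powr (t - 1) + a powr t) * (norm z + 1)"
proof -
  have zpos: "0 < norm z"
    using assms(3) by auto
  have "norm (of_real b powr of_real t * (z / (of_real b + z))) = b powr t * (norm z / norm (of_real b + z))"
    using assms by (simp add: norm_mult norm_divide norm_powr_real_powr)
  also have "\<dots> \<le> b powr t * (norm z / b)"
    using norm_of_real_add_ge(1)[of b z] assms
    by (intro mult_left_mono divide_left_mono mult_pos_pos) auto
  also have "\<dots> = b powr (t - 1) * norm z"
    using assms by (simp add: powr_diff)
  finally have b: "norm (of_real b powr of_real t * (z / (of_real b + z))) \<le> b powr (t - 1) * norm z" .
  have "norm (of_real a powr of_real t * (z / (of_real a + z))) = a powr t * (norm z / norm (of_real a + z))"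
    using assms by (simp add: norm_mult norm_divide norm_powr_real_powr)
  also have "\<dots> \<le> a powr t * 1"
    using norm_of_real_add_ge(2)[of a z] assms zpos by (intro mult_left_mono) (auto simp: divide_le_eq_1)
  finally have a: "norm (of_real a powr of_real t * (z / (of_real a + z))) \<le> a powr t"
    by simp
  have "b powr (t - 1) * norm z + a powr t \<le> (b powr (t - 1) + a powr t) * (norm z + 1)"
    by (simp add: algebra_simps)
  then show ?thesis
    using norm_triangle_ineq4 a b by (smt (verit))
qed

text \<open>At the real centre the integrand is real and nonnegative; this makes the approximation
  factor nonnegative.\<close>

lemma truncated_power_of_real:
  assumes "0 < a" "0 < c"
  obtains k where "0 \<le> k" "truncated_power t a b (of_real c) = of_real k"
proof
  let ?f = "\<lambda>s. s powr (t - 1) * (c / (s + c))"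
  have int: "?f integrable_on {a..b}"
    using assms by (intro integrable_continuous_interval) (auto intro!: continuous_intros)
  have "truncated_power t a b (of_real c) = integral {a..b} (\<lambda>s. of_real (?f s))"
    unfolding truncated_power_def using assms by (intro integral_cong) (simp add: powr_of_real[symmetric])
  then show "truncated_power t a b (of_real c) = of_real (integral {a..b} ?f)"
    by (simp only: integral_unique[OF has_integral_of_real[OF integrable_integral[OF int]]])
  show "0 \<le> integral {a..b} ?f"
    using assms by (intro integral_nonneg int) auto
qed

text \<open>For f the truncated power, F = f z^(-t) has derivative -z^(-t-1) times the small
  boundary terms. Hence F is nearly constant on the disc, and its value at \<open>c\<close> supplies
  \<open>k\<close>.\<close>

lemma truncated_power_approx:
  assumes t: "0 < t" "t < 1" and r: "0 < r" "r < c" and "0 < \<epsilon>"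
  obtains a b k where "0 < a" "a \<le> 1" "2 \<le> b" "0 \<le> k"
    "\<And>z. z \<in> cball (of_real c) r \<Longrightarrow>
      norm (truncated_power t a b z - of_real k * z powr of_real t) \<le> \<epsilon>"
proof -
  let ?S = "cball (complex_of_real c) r"
  have Re: "0 < Re z" if "z \<in> ?S" for z
    using that abs_Re_le_cmod[of "z - of_real c"] r by (auto simp: dist_norm norm_minus_commute)
  have slit: "z \<notin> \<real>\<^sub>\<le>\<^sub>0" "z \<noteq> 0" if "z \<in> ?S" for z
    using Re[OF that] by (auto simp: complex_nonpos_Reals_iff)
  have pw: "continuous_on ?S (\<lambda>z. z powr w)" for w
    using slit by (intro holomorphic_on_imp_continuous_on holomorphic_intros)
  have "bounded ((\<lambda>z. norm (z powr (- of_real t - 1)) * (norm z + 1)) ` ?S)"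
    by (intro compact_imp_bounded compact_continuous_image) (auto intro!: continuous_intros pw)
  then obtain M where M: "0 < M" "\<And>z. z \<in> ?S \<Longrightarrow> norm (z powr (- of_real t - 1)) * (norm z + 1) \<le> M"
    unfolding bounded_pos by auto
  have "bounded ((\<lambda>z. z powr of_real t) ` ?S)"
    by (intro compact_imp_bounded compact_continuous_image) (auto intro!: continuous_intros pw)
  then obtain L where L: "0 < L" "\<And>z. z \<in> ?S \<Longrightarrow> norm (z powr of_real t) \<le> L"
    unfolding bounded_pos by auto
  \<comment> \<open>Chosen so that the final error 2 \<delta> M r L is exactly \<epsilon>.\<close>
  define \<delta> where "\<delta> = \<epsilon> / (2 * L * M * r)"
  have \<delta>: "0 < \<delta>" "2 * \<delta> * M * r * L = \<epsilon>"
    using L(1) M(1) r \<open>0 < \<epsilon>\<close> by (auto simp: \<delta>_def)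
  \<comment> \<open>These make a^t and b^(t-1) at most \<delta>, the latter because the exponent t -
    1 is negative. The \<open>min\<close> and \<open>max\<close> ensure that [a, b] contains
    [1, 2].\<close>
  define a where "a = min 1 (\<delta> powr (1 / t))"
  define b where "b = max 2 (\<delta> powr (1 / (t - 1)))"
  have a: "0 < a" "a \<le> 1" and b: "2 \<le> b"
    using \<delta>(1) by (auto simp: a_def b_def)
  have "a powr t \<le> (\<delta> powr (1 / t)) powr t"
    using t a by (intro powr_mono2) (auto simp: a_def)
  moreover have "b powr (t - 1) \<le> (\<delta> powr (1 / (t - 1))) powr (t - 1)"
    using t \<delta>(1) by (intro powr_mono2') (auto simp: b_def)
  ultimately have ab: "b powr (t - 1) + a powr t \<le> 2 * \<delta>"
    using t \<delta>(1) by (simp add: powr_powr)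
  define F where "F = (\<lambda>z. truncated_power t a b z * z powr (- of_real t))"
  define E where "E = (\<lambda>z :: complex. of_real b powr of_real t * (z / (of_real b + z))
    - of_real a powr of_real t * (z / (of_real a + z)))"
  have deriv: "(F has_field_derivative - (z powr (- of_real t - 1) * E z)) (at z)" if "z \<in> ?S" for z
  proof -
    define K' where "K' = integral {a..b} (\<lambda>s. of_real s powr of_real (t - 1) * (of_real s / (of_real s + z)\<^sup>2))"
    have deriv: "(F has_field_derivative
        K' * z powr (- of_real t) + (- of_real t * z powr (- of_real t - 1)) * truncated_power t a b z) (at z)"
      unfolding F_def K'_def using a that slit Re
      by (intro DERIV_mult has_field_derivative_powr has_field_derivative_truncated_power) auto
    have E_z: "E z = of_real t * truncated_power t a b z - z * K'"
      unfolding E_def K'_def using a b that Re by (intro truncated_power_ode[symmetric]) auto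
    have powr_z: "z powr (- of_real t) = z * z powr (- of_real t - 1)"
      using slit[OF that] by (simp add: powr_diff)
    have "K' * z powr (- of_real t) + (- of_real t * z powr (- of_real t - 1)) * truncated_power t a b z
        = - (z powr (- of_real t - 1) * E z)"
      unfolding E_z powr_z by (simp add: algebra_simps)
    with deriv show ?thesis
      by simp
  qed
  have bound: "norm (- (z powr (- of_real t - 1) * E z)) \<le> 2 * \<delta> * M" if "z \<in> ?S" for z
  proof -
    have "norm (E z) \<le> 2 * \<delta> * (norm z + 1)"
      unfolding E_def using a b Re[OF that] ab
      by (intro order_trans[OF norm_boundary_terms_le] mult_right_mono) auto
    then have "norm (z powr (- of_real t - 1) * E z) \<le> norm (z powr (- of_real t - 1)) * (2 * \<delta> * (norm z + 1))"
      by (simp add: norm_mult mult_left_mono)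
    also have "\<dots> = 2 * \<delta> * (norm (z powr (- of_real t - 1)) * (norm z + 1))"
      by simp
    also have "\<dots> \<le> 2 * \<delta> * M"
      using M(2)[OF that] \<delta>(1) by (intro mult_left_mono) auto
    finally show ?thesis
      by simp
  qed
  obtain k0 where k0: "0 \<le> k0" "truncated_power t a b (of_real c) = of_real k0"
    using truncated_power_of_real[of a c t b] a r by auto
  have F_c: "F (of_real c) = of_real (k0 * c powr - t)"
    using r by (simp add: F_def k0(2) powr_of_real[symmetric])
  have "norm (truncated_power t a b z - of_real (k0 * c powr - t) * z powr of_real t) \<le> \<epsilon>"
    if "z \<in> ?S" for z
  proof -
    \<comment> \<open>Mean value estimate on the convex disc, measured from its centre.\<close>
    have "norm (F z - F (of_real c)) \<le> 2 * \<delta> * M * norm (z - of_real c)"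
      using deriv bound that r
      by (intro field_differentiable_bound[of ?S F "\<lambda>z. - (z powr (- of_real t - 1) * E z)"])
        (auto intro: has_field_derivative_at_within)
    also have "\<dots> \<le> 2 * \<delta> * M * r"
      using that M(1) \<delta>(1) by (intro mult_left_mono) (auto simp: dist_norm norm_minus_commute)
    finally have "norm (F z - F (of_real c)) * norm (z powr of_real t) \<le> (2 * \<delta> * M * r) * L"
      using L(2)[OF that] M(1) \<delta>(1) r by (intro mult_mono) auto
    moreover have "z powr (- of_real t) * z powr of_real t = 1"
      using slit[OF that] by (simp add: powr_minus)
    then have "(F z - F (of_real c)) * z powr of_real t
        = truncated_power t a b z - of_real (k0 * c powr - t) * z powr of_real t"
      unfolding F_c by (simp add: F_def algebra_simps)
    ultimately show ?thesis
      using \<delta>(2) by (simp add: norm_mult[symmetric])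
  qed
  then show ?thesis
    using a b k0(1) by (intro that[of a b "k0 * c powr - t"]) auto
qed

subsection \<open>Positivity\<close>

context resolvent_disc
begin

lemma neg_real_outside_disc:
  assumes "0 < s"
  shows "r < norm (- complex_of_real s - of_real c)"
proof -
  have "norm (- complex_of_real s - of_real c) = s + c"
    using assms r_less r_pos by (simp flip: of_real_minus of_real_diff)
  then show ?thesis
    using assms r_less by simp
qed

lemma neg_real_mem_resolvent_set: "0 < s \<Longrightarrow> - complex_of_real s \<in> resolvent_set A"
  using neg_real_outside_disc[of s] rho_less by (intro mem_resolvent_set) simp

text \<open>Write z / (s + z) = 1 - s / (z + s) and apply the Cauchy formula at the exterior point
  -s. As R(-s) = -(sI + A)^(-1), the bracket is <A(sI + A)^(-1)v, x>.\<close>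

lemma contour_integral_kernel_resolvent_form:
  assumes "0 < s"
  shows "contour_integral (circlepath (of_real c) r) (\<lambda>z. z / (of_real s + z) * resolvent_form A v x z)
       = 2 * of_real pi * \<i> * (herm_inner v x + of_real s * resolvent_form A v x (- of_real s))"
proof -
  let ?C = "circlepath (of_real c) r"
  have nz: "z + of_real s \<noteq> 0" if "z \<in> sphere (complex_of_real c) r" for z
    using Re_pos_if_mem_disc[of z] that assms by (auto simp: complex_eq_iff)
  have "(\<lambda>z. resolvent_form A v x z / (z - - of_real s)) contour_integrable_on ?C"
    using nz r_pos sphere_subset_resolvent_set[of r]
    by (intro contour_integrable_continuous_circlepath continuous_intros
        continuous_on_subset[OF holomorphic_on_imp_continuous_on[OF holomorphic_resolvent_form]]) auto
  from has_contour_integral_integral[OF this]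
  have "((\<lambda>z. resolvent_form A v x z / (z - - of_real s)) has_contour_integral
      - 2 * of_real pi * \<i> * resolvent_form A v x (- of_real s)) ?C"
    by (simp only: contour_integral_resolvent_form_Cauchy[OF neg_real_outside_disc[OF assms]])
  moreover have "(resolvent_form A v x has_contour_integral 2 * of_real pi * \<i> * herm_inner v x) ?C"
    using has_contour_integral_integral[OF resolvent_form_integrable[OF order_refl]]
    by (simp only: contour_integral_resolvent_form)
  ultimately have "((\<lambda>z. resolvent_form A v x z
        - of_real s * (resolvent_form A v x z / (z - - of_real s))) has_contour_integral
      2 * of_real pi * \<i> * herm_inner v x
        - of_real s * (- 2 * of_real pi * \<i> * resolvent_form A v x (- of_real s))) ?C"
    by (intro has_contour_integral_diff has_contour_integral_lmul)
  then have "((\<lambda>z. z / (of_real s + z) * resolvent_form A v x z) has_contour_integral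
      2 * of_real pi * \<i> * herm_inner v x
        - of_real s * (- 2 * of_real pi * \<i> * resolvent_form A v x (- of_real s))) ?C"
  proof (rule has_contour_integral_eq)
    fix z assume "z \<in> path_image ?C"
    then have "z + of_real s \<noteq> 0"
      using nz r_pos by simp
    then show "resolvent_form A v x z - of_real s * (resolvent_form A v x z / (z - - of_real s))
        = z / (of_real s + z) * resolvent_form A v x z"
      by (simp add: field_simps)
  qed
  then show ?thesis
    by (simp add: contour_integral_unique algebra_simps)
qed

text \<open>The integral over [a, b] is rewritten as a contour integral along a segment, so that the
  exchange theorem for two contour integrals applies.\<close>

lemma contour_integral_truncated_power:
  assumes "0 < a" "a < b"
  shows "contour_integral (circlepath (of_real c) r) (\<lambda>z. truncated_power t a b z * resolvent_form A v x z)
       = 2 * of_real pi * \<i> * integral {a..b} (\<lambda>s. of_real (s powr (t - 1)) *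
           (herm_inner v x + of_real s * resolvent_form A v x (- of_real s)))"
proof -
  let ?C = "circlepath (of_real c) r" and ?L = "linepath (complex_of_real a) (of_real b)"
  let ?G = "resolvent_form A v x"
  let ?f = "\<lambda>z s. s powr of_real (t - 1) * (z / (s + z)) * ?G z"
  have seg: "\<exists>s'. s = of_real s' \<and> a \<le> s' \<and> s' \<le> b" if "s \<in> closed_segment (of_real a) (of_real b)" for s :: complex
    using that assms by (auto simp: closed_segment_of_real closed_segment_eq_real_ivl)
  have neq: "s + z \<noteq> 0"
    if "s \<in> closed_segment (of_real a) (of_real b)" "z \<in> sphere (of_real c) r" for s z :: complex
    using seg[OF that(1)] Re_pos_if_mem_disc[of z] that(2) assms by (auto simp: complex_eq_iff)
  have pw: "continuous_on (closed_segment (complex_of_real a) (of_real b)) (\<lambda>s. s powr of_real (t - 1))"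
    using seg assms
    by (intro holomorphic_on_imp_continuous_on holomorphic_intros) (force simp: complex_nonpos_Reals_iff)
  have G: "continuous_on (sphere (of_real c) r) ?G"
    using sphere_subset_resolvent_set[of r]
    by (intro continuous_on_subset[OF holomorphic_on_imp_continuous_on[OF holomorphic_resolvent_form]]) auto
  have cont: "continuous_on (path_image ?C \<times> path_image ?L) (\<lambda>(z, s). ?f z s)"
    unfolding case_prod_beta using r_pos
    by (intro continuous_on_mult continuous_on_divide continuous_on_add continuous_on_fst
        continuous_on_snd continuous_on_id continuous_on_compose2[OF G] continuous_on_compose2[OF pw])
      (auto dest: neq)
  have vdC: "continuous_on {0..1} (\<lambda>u. vector_derivative ?C (at u))"
    unfolding vector_derivative_circlepath by (intro continuous_intros)
  have vdL: "continuous_on {0..1} (\<lambda>u. vector_derivative ?L (at u))"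
    by simp
  have "contour_integral ?C (\<lambda>z. truncated_power t a b z * ?G z)
      = contour_integral ?C (\<lambda>z. contour_integral ?L (?f z))"
    using assms
    by (simp add: contour_integral_linepath_Reals_eq truncated_power_def flip: integral_mult_left)
  also have "\<dots> = contour_integral ?L (\<lambda>s. contour_integral ?C (\<lambda>z. ?f z s))"
    using cont vdC vdL by (intro contour_integral_swap) auto
  also have "\<dots> = integral {a..b} (\<lambda>s. contour_integral ?C (\<lambda>z. ?f z (of_real s)))"
    using assms by (simp add: contour_integral_linepath_Reals_eq)
  also have "\<dots> = integral {a..b} (\<lambda>s. 2 * of_real pi * \<i> * (of_real (s powr (t - 1)) *
      (herm_inner v x + of_real s * ?G (- of_real s))))"
  proof (rule integral_cong)
    fix s assume "s \<in> {a..b}"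
    then have s: "0 < s"
      using assms by simp
    have "of_real s + z \<noteq> 0" if "z \<in> sphere (complex_of_real c) r" for z
      using that by (intro add_of_real_neq_0[OF s] Re_pos_if_mem_disc) auto
    then have "(\<lambda>z. z / (of_real s + z) * ?G z) contour_integrable_on ?C"
      using r_pos G
      by (intro contour_integrable_continuous_circlepath continuous_on_mult continuous_on_divide
          continuous_on_add continuous_on_const continuous_on_id) auto
    then have "contour_integral ?C (\<lambda>z. of_real (s powr (t - 1)) * (z / (of_real s + z) * ?G z))
        = of_real (s powr (t - 1)) * (2 * of_real pi * \<i> * (herm_inner v x + of_real s * ?G (- of_real s)))"
      by (simp only: contour_integral_lmul contour_integral_kernel_resolvent_form[OF s])
    then show "contour_integral ?C (\<lambda>z. ?f z (of_real s))
        = 2 * of_real pi * \<i> * (of_real (s powr (t - 1)) * (herm_inner v x + of_real s * ?G (- of_real s)))"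
      using s by (simp add: powr_of_real[symmetric] mult_ac)
  qed
  finally show ?thesis
    by simp
qed

text \<open>The factor \<open>w\<close> treats real and imaginary part at once, as \<open>Im u = Re (- \<i> u)\<close>.\<close>

lemma Re_frac_power_pos:
  assumes t: "0 < t" "t < 1" and "norm w = 1"
    and pos: "\<And>s. 0 < s \<Longrightarrow> 0 < Re (w * (herm_inner x x + of_real s * resolvent_form A x x (- of_real s)))"
  shows "0 < Re (w * herm_inner (frac_power A t *v x) x)"
proof (rule ccontr)
  assume neg: "\<not> ?thesis"
  let ?C = "circlepath (of_real c) r" and ?G = "resolvent_form A x x"
  let ?\<Phi> = "\<lambda>f. 1 / (2 * of_real pi * \<i>) * contour_integral ?C (\<lambda>z. f z * ?G z)"
  define h where "h = (\<lambda>s. s powr (t - 1) * Re (w * (herm_inner x x + of_real s * ?G (- of_real s))))"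
  have "continuous_on {0<..} (\<lambda>s. ?G (- of_real s))"
    using neg_real_mem_resolvent_set
    by (intro continuous_on_compose2[OF holomorphic_on_imp_continuous_on[OF holomorphic_resolvent_form]]
        continuous_intros) auto
  then have G_neg: "continuous_on {a..b} (\<lambda>s. ?G (- of_real s))" if "0 < a" for a b
    using that by (elim continuous_on_subset) auto
  have h_cont: "continuous_on {a..b} h" if "0 < a" for a b
    unfolding h_def using that
    by (auto intro!: continuous_intros G_neg)
  have h_pos: "0 < h s" if "0 < s" for s
    unfolding h_def using that pos by simp
  have h_int: "h integrable_on {a..b}" if "0 < a" for a b
    using h_cont[OF that] by (rule integrable_continuous_interval)
  \<comment> \<open>The minimum over [1, 2] bounds the integral of \<open>h\<close> over any larger
    [a, b] from below, since \<open>h\<close> is positive and [1, 2] has length 1. The bound does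
    not depend on \<open>a\<close> and \<open>b\<close>, which are chosen later.\<close>
  obtain s0 where s0: "s0 \<in> {1..2}" "\<And>s. s \<in> {1..2} \<Longrightarrow> h s0 \<le> h s"
    using continuous_attains_inf[of "{1..2}" h] h_cont[of 1 2] by auto
  define \<eta> where "\<eta> = h s0"
  have \<eta>: "0 < \<eta>"
    unfolding \<eta>_def using s0(1) by (intro h_pos) auto
  have lower: "\<eta> \<le> Re (w * ?\<Phi> (truncated_power t a b))" if ab: "0 < a" "a \<le> 1" "2 \<le> b" for a b
  proof -
    let ?H = "\<lambda>s. of_real (s powr (t - 1)) * (herm_inner x x + of_real s * ?G (- of_real s))"
    have "?H integrable_on {a..b}"
      using ab by (intro integrable_continuous_interval)
        (auto intro!: continuous_intros G_neg)
    then have "((\<lambda>s. Re (w * ?H s)) has_integral Re (w * integral {a..b} ?H)) {a..b}"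
      by (intro has_integral_Re has_integral_mult_right integrable_integral)
    moreover have "Re (w * ?H s) = h s" for s
      by (simp add: h_def algebra_simps)
    ultimately have "integral {a..b} h = Re (w * integral {a..b} ?H)"
      by (simp add: integral_unique)
    also have "integral {a..b} ?H = ?\<Phi> (truncated_power t a b)"
      using ab by (simp add: contour_integral_truncated_power)
    finally have "integral {a..b} h = Re (w * ?\<Phi> (truncated_power t a b))" .
    moreover have "integral {1..2::real} (\<lambda>_. \<eta>) \<le> integral {1..2} h"
      using s0(2) h_int[of 1 2] by (intro integral_le) (auto simp: \<eta>_def)
    moreover have "integral {1..2} h \<le> integral {a..b} h"
      using ab h_int[of 1 2] h_int[of a b] by (intro integral_subset_le) (auto intro!: less_imp_le h_pos)
    ultimately show ?thesis
      by simp
  qed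
  have G_cont: "continuous_on (sphere (of_real c) r) ?G"
    using sphere_subset_resolvent_set[of r]
    by (intro continuous_on_subset[OF holomorphic_on_imp_continuous_on[OF holomorphic_resolvent_form]]) auto
  then have "bounded (?G ` sphere (of_real c) r)"
    by (intro compact_imp_bounded compact_continuous_image) auto
  then obtain M where M: "0 < M" "\<And>z. z \<in> sphere (of_real c) r \<Longrightarrow> norm (?G z) \<le> M"
    unfolding bounded_pos by auto
  \<comment> \<open>After division by 2 pi, a uniform error \<epsilon> on the circle contributes at
    most \<epsilon> M r, which is half of the lower bound \<eta>.\<close>
  define \<epsilon> where "\<epsilon> = \<eta> / (2 * M * r)"
  have \<epsilon>: "0 < \<epsilon>" "\<epsilon> * M * r = \<eta> / 2"
    using \<eta> M(1) r_pos by (auto simp: \<epsilon>_def)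
  obtain a b k where ab: "0 < a" "a \<le> 1" "2 \<le> b" "0 \<le> k"
    and approx: "\<And>z. z \<in> cball (of_real c) r \<Longrightarrow>
      norm (truncated_power t a b z - of_real k * z powr of_real t) \<le> \<epsilon>"
    using truncated_power_approx[OF t r_pos r_less \<epsilon>(1)] by metis
  have tp_cont: "continuous_on (sphere (of_real c) r) (truncated_power t a b)"
  proof (intro continuous_at_imp_continuous_on ballI)
    fix z assume "z \<in> sphere (complex_of_real c) r"
    then have "0 < Re z"
      by (intro Re_pos_if_mem_disc) simp
    then show "isCont (truncated_power t a b) z"
      by (rule DERIV_isCont[OF has_field_derivative_truncated_power[OF ab(1)]])
  qed
  have pw_cont: "continuous_on (sphere (complex_of_real c) r) (\<lambda>z. z powr of_real t)"
    using disc_subset_slit_plane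
    by (intro holomorphic_on_imp_continuous_on holomorphic_intros) auto
  have int: "(\<lambda>z. truncated_power t a b z * ?G z) contour_integrable_on ?C"
    "(\<lambda>z. z powr of_real t * ?G z) contour_integrable_on ?C"
    using r_pos G_cont tp_cont pw_cont
    by (auto intro!: contour_integrable_continuous_circlepath continuous_on_mult)
  define \<Delta> where "\<Delta> = contour_integral ?C (\<lambda>z. truncated_power t a b z * ?G z)
    - of_real k * contour_integral ?C (\<lambda>z. z powr of_real t * ?G z)"
  have "((\<lambda>z. (truncated_power t a b z - of_real k * z powr of_real t) * ?G z) has_contour_integral \<Delta>) ?C"
    unfolding \<Delta>_def
    using has_contour_integral_diff[OF has_contour_integral_integral[OF int(1)]
        has_contour_integral_lmul[OF has_contour_integral_integral[OF int(2)], of "of_real k"]]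
    by (simp only: left_diff_distrib mult.assoc)
  then have "norm \<Delta> \<le> \<epsilon> * M * (2 * pi * r)"
    using \<epsilon>(1) M approx r_pos
    by (elim has_contour_integral_bound_circlepath)
      (auto simp: norm_mult dist_norm norm_minus_commute intro!: mult_mono)
  then have "norm \<Delta> / (2 * pi) \<le> \<epsilon> * M * (2 * pi * r) / (2 * pi)"
    by (intro divide_right_mono) auto
  moreover have "?\<Phi> (truncated_power t a b) - of_real k * ?\<Phi> (\<lambda>z. z powr of_real t) = \<Delta> / (2 * of_real pi * \<i>)"
    by (simp add: \<Delta>_def field_simps)
  moreover have "norm (\<Delta> / (2 * of_real pi * \<i>)) = norm \<Delta> / (2 * pi)"
    by (simp add: norm_divide norm_mult)
  ultimately have "norm (?\<Phi> (truncated_power t a b) - of_real k * ?\<Phi> (\<lambda>z. z powr of_real t)) \<le> \<epsilon> * M * r"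
    by simp
  then have "norm (w * (?\<Phi> (truncated_power t a b) - of_real k * ?\<Phi> (\<lambda>z. z powr of_real t))) \<le> \<eta> / 2"
    using \<epsilon>(2) \<open>norm w = 1\<close> by (simp add: norm_mult)
  then have "Re (w * (?\<Phi> (truncated_power t a b) - of_real k * ?\<Phi> (\<lambda>z. z powr of_real t))) \<le> \<eta> / 2"
    using complex_Re_le_cmod order_trans by blast
  moreover have "w * (?\<Phi> (truncated_power t a b) - of_real k * ?\<Phi> (\<lambda>z. z powr of_real t))
      = w * ?\<Phi> (truncated_power t a b) - of_real k * (w * herm_inner (frac_power A t *v x) x)"
    unfolding herm_inner_frac_power by (simp add: algebra_simps)
  moreover have "Re (p - of_real k * q) = Re p - k * Re q" for p q
    by simp
  \<comment> \<open>Only the sign of \<open>k\<close> enters: the assumed nonpositive value stays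
    nonpositive, which forces the truncated integral below \<eta> / 2.\<close>
  moreover have "k * Re (w * herm_inner (frac_power A t *v x) x) \<le> 0"
    using neg ab(4) by (intro mult_nonneg_nonpos) auto
  ultimately have "Re (w * ?\<Phi> (truncated_power t a b)) \<le> \<eta> / 2"
    by (smt (verit))
  then show False
    using lower[OF ab(1-3)] \<eta> by linarith
qed

end

text \<open>If \<open>\<delta>\<close> is the minimum of \<open>Re \<langle>Ay, y\<rangle>\<close> and \<open>M\<close> bounds \<open>\<parallel>Ay\<parallel>\<close> on the unit sphere, then
  \<open>\<parallel>Ay - cy\<parallel>\<^sup>2 \<le> M\<^sup>2 - 2c\<delta> + c\<^sup>2\<close>, which is below \<open>c\<^sup>2\<close> for \<open>c = M\<^sup>2/\<delta>\<close>.\<close>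

lemma accretive_imp_resolvent_disc:
  fixes A :: "complex ^ 'n ^ 'n"
  assumes "\<And>x. x \<noteq> 0 \<Longrightarrow> 0 < Re (herm_inner (A *v x) x)"
  obtains c r \<rho> where "resolvent_disc A c r \<rho>"
proof -
  let ?S = "sphere 0 1 :: (complex ^ 'n) set"
  have scale: "x = of_real (norm x) *s y \<and> norm y = 1"
    if "y = of_real (1 / norm x) *s x" "x \<noteq> 0" for x y :: "complex ^ 'n"
    using that by (simp add: norm_scalar_mult_vec norm_divide vector_smult_assoc)
  \<comment> \<open>\<open>undefined\<close> serves as an arbitrary index.\<close>
  have "axis undefined 1 \<in> ?S"
    by (simp add: norm_axis_1)
  then have ne: "?S \<noteq> {}" by blast
  have cont: "continuous_on ?S (\<lambda>x. Re (herm_inner (A *v x) x))"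
    unfolding herm_inner_def matrix_vector_mult_def by (auto intro!: continuous_intros)
  obtain x0 where x0: "x0 \<in> ?S" "\<And>x. x \<in> ?S \<Longrightarrow> Re (herm_inner (A *v x0) x0) \<le> Re (herm_inner (A *v x) x)"
    using continuous_attains_inf[OF compact_sphere ne cont] by blast
  define \<delta> where "\<delta> = Re (herm_inner (A *v x0) x0)"
  have \<delta>: "0 < \<delta>"
    unfolding \<delta>_def using x0(1) by (intro assms) auto
  obtain M where M: "0 < M" "\<And>x. norm (A *v x) \<le> norm x * M"
    using bounded_linear.pos_bounded[OF matrix_vector_mul_bounded_linear[of A]] by blast
  define c where "c = M\<^sup>2 / \<delta>"
  \<comment> \<open>This is M^2 - 2c\<delta> + c^2 after inserting c\<delta> = M^2.\<close>
  define Q where "Q = c\<^sup>2 - M\<^sup>2"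
  have c: "0 < c" "c * \<delta> = M\<^sup>2"
    using M(1) \<delta> by (auto simp: c_def)
  have unit: "(norm (A *v y - of_real c *s y))\<^sup>2 \<le> Q" if "norm y = 1" for y
  proof -
    have comm: "herm_inner y (A *v y) = cnj (herm_inner (A *v y) y)"
      by (rule herm_inner_commute)
    have "complex_of_real ((norm (A *v y - of_real c *s y))\<^sup>2)
        = herm_inner (A *v y) (A *v y) - of_real c * (herm_inner (A *v y) y + cnj (herm_inner (A *v y) y))
          + of_real (c\<^sup>2) * herm_inner y y"
      unfolding herm_inner_self[symmetric]
      by (simp add: comm herm_inner_diff_left herm_inner_diff_right herm_inner_scale_left
          herm_inner_scale_right algebra_simps power2_eq_square)
    also have "\<dots> = of_real ((norm (A *v y))\<^sup>2 - 2 * c * Re (herm_inner (A *v y) y) + c\<^sup>2)"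
      using that by (simp add: herm_inner_self complex_add_cnj)
    finally have "(norm (A *v y - of_real c *s y))\<^sup>2
        = (norm (A *v y))\<^sup>2 - 2 * c * Re (herm_inner (A *v y) y) + c\<^sup>2"
      by (simp only: of_real_eq_iff)
    moreover have "c * \<delta> \<le> c * Re (herm_inner (A *v y) y)"
      using x0(2)[of y] that c(1) by (intro mult_left_mono) (auto simp: \<delta>_def)
    moreover have "(norm (A *v y))\<^sup>2 \<le> M\<^sup>2"
      using M(2)[of y] that by (intro power_mono) auto
    ultimately show ?thesis
      using c(2) by (simp add: Q_def)
  qed
  have contraction: "norm (A *v x - of_real c *s x) \<le> sqrt Q * norm x" for x
  proof (cases "x = 0")
    case False
    define y where "y = of_real (1 / norm x) *s x"
    have y: "x = of_real (norm x) *s y" "norm y = 1"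
      using scale[OF y_def False] by auto
    have "A *v x - of_real c *s x = of_real (norm x) *s (A *v y - of_real c *s y)"
      by (subst (1 2) y(1)) (simp add: vector_scalar_commute vector_ssub_ldistrib vector_smult_assoc mult.commute)
    then have "norm (A *v x - of_real c *s x) = norm x * norm (A *v y - of_real c *s y)"
      by (simp only: norm_scalar_mult_vec norm_of_real abs_norm_cancel)
    also have "\<dots> \<le> norm x * sqrt Q"
      using unit[OF y(2)] by (intro mult_left_mono real_le_rsqrt) auto
    finally show ?thesis
      by (simp add: mult.commute)
  qed simp
  have "0 \<le> Q"
    using unit[of x0] x0(1) order_trans[OF zero_le_power2] by auto
  moreover have "sqrt Q < c"
    using M(1) c(1) by (intro real_less_lsqrt) (auto simp: Q_def)
  then obtain r where "sqrt Q < r" "r < c"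
    using dense by blast
  ultimately have "resolvent_disc A c r (sqrt Q)"
    using contraction by unfold_locales auto
  then show ?thesis
    by (rule that)
qed

theorem proposition3p3:
  fixes A :: "complex ^ 'n ^ 'n" and t :: real
  assumes "accretive_dissipative A"
    and "0 < t" and "t < 1"
  shows "accretive_dissipative (frac_power A t)"
proof -
  have A: "0 < Re (herm_inner (A *v y) y)" "0 < Im (herm_inner (A *v y) y)" if "y \<noteq> 0" for y
    using assms(1) that unfolding accretive_dissipative_iff by auto
  then obtain c r \<rho> where "resolvent_disc A c r \<rho>"
    using accretive_imp_resolvent_disc by blast
  then interpret resolvent_disc A c r \<rho> .
  show ?thesis
    unfolding accretive_dissipative_iff
  proof (intro allI impI)
    fix x :: "complex ^ 'n" assume "x \<noteq> 0"
    have pos: "0 < Re (herm_inner x x + of_real s * resolvent_form A x x (- of_real s))"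
      "0 < Im (herm_inner x x + of_real s * resolvent_form A x x (- of_real s))" if "0 < s" for s
    proof -
      \<comment> \<open>As u = (-sI - A)^(-1)x, the sign change gives y = (sI + A)^(-1)x, and x = sy
        + Ay.\<close>
      define u where "u = matrix_inv (mat (- of_real s) - A) *v x"
      define y where "y = (-1) *s u"
      have u: "(- of_real s) *s u - A *v u = x"
        unfolding u_def by (intro resolvent_eq neg_real_mem_resolvent_set that)
      have Ay: "A *v y = (-1) *s (A *v u)"
        unfolding y_def by (rule vector_scalar_commute)
      have sy: "of_real s *s y = (- of_real s) *s u"
        by (simp add: y_def vec_eq_iff)
      have x: "x = of_real s *s y + A *v y"
        unfolding Ay sy u[symmetric] by simp
      then have "y \<noteq> 0"
        using \<open>x \<noteq> 0\<close> by auto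
      have "herm_inner x x + of_real s * resolvent_form A x x (- of_real s)
          = herm_inner (x - of_real s *s y) x"
        unfolding herm_inner_diff_left herm_inner_scale_left resolvent_form_def y_def u_def by simp
      \<comment> \<open>Expanding \<open>x\<close> in the second slot too expresses everything
        through the form of \<open>A\<close> at \<open>y\<close> and |Ay|^2; the latter affects only
        the real part.\<close>
      also have "\<dots> = herm_inner (A *v y) (of_real s *s y + A *v y)"
        using x by (metis add_diff_cancel_left')
      also have "\<dots> = of_real s * herm_inner (A *v y) y + of_real ((norm (A *v y))\<^sup>2)"
        by (simp add: herm_inner_add_right herm_inner_scale_right herm_inner_self)
      finally show "0 < Re (herm_inner x x + of_real s * resolvent_form A x x (- of_real s))"
        "0 < Im (herm_inner x x + of_real s * resolvent_form A x x (- of_real s))"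
        using A[OF \<open>y \<noteq> 0\<close>] that by (simp_all add: add_pos_nonneg flip: of_real_power)
    qed
    show "0 < Re (herm_inner (frac_power A t *v x) x) \<and> 0 < Im (herm_inner (frac_power A t *v x) x)"
      \<comment> \<open>The factor 1 gives the real part, the factor \<open>- \<i>\<close> the
        imaginary part.\<close>
      using Re_frac_power_pos[OF assms(2,3), of 1 x] Re_frac_power_pos[OF assms(2,3), of "- \<i>" x] pos
      by (simp add: add.commute)
  qed
qed

end
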